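(* Let $N\ge N_M$ and let $\mathbf y=(y_1,\dots,y_N)\in\Omega^N$ satisfy $\operatorname{rank}C_M(\mathbf y)=N_M$; let $L_M\in\mathbb R^{N\times N_M}$ be a right inverse, $C_M(\mathbf y)L_M=I_{N_M}$. Let $T>0$ and let $\boldsymbol p_r\in C^3([0,T];\mathbb R^{N_M})$ satisfy $\boldsymbol p_r(0)=0$ and $\dot{\boldsymbol p}_r(0)=0$. Define $$\mathbf q^{\mathrm{ideal}}(t):=\frac1{c_0^2}L_M\bigl(\ddot{\boldsymbol p}_r(t)+\Lambda_M\boldsymbol p_r(t)\bigr),\qquad t\in[0,T].$$ Let $\boldsymbol p^M$ be the unique solution of $$\ddot{\boldsymbol p}^M(t)+\Lambda_M\boldsymbol p^M(t)=c_0^2C_M(\mathbf y)\mathbf q(t),\qquad \boldsymbol p^M(0)=\dot{\boldsymbol p}^M(0)=0,$$ driven by $\mathbf q=\mathbf q^{\mathrm{ideal}}$. Then $$\boldsymbol p^M(t)=\boldsymbol p_r(t),\qquad \dot{\boldsymbol p}^M(t)=\dot{\boldsymbol p}_r(t),\qquad t\in[0,T],$$ and consequently $$P_{I_M}p(\cdot,t)=p_r^{I_M}(\cdot,t),\qquad P_{I_M}\partial_tp(\cdot,t)=\partial_tp_r^{I_M}(\cdot,t),\qquad t\in[0,T].$$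
   Context: $\Omega\subset\mathbb R^3$ is a bounded $C^{1,1}$ domain and $c_0>0$. $\psi_1,\dots,\psi_{N_M}$ are $L^2(\Omega)$-orthonormal eigenfunctions of the Dirichlet Laplacian $-\Delta_D$ on $\Omega$ with eigenvalues $\lambda_1,\dots,\lambda_{N_M}>0$; $\omega_k=c_0\sqrt{\lambda_k}$; $H_M=\operatorname{span}\{\psi_1,\dots,\psi_{N_M}\}$; $\Lambda_M=\operatorname{diag}(\omega_1^2,\dots,\omega_{N_M}^2)$; $C_M(\mathbf y)\in\mathbb R^{N_M\times N}$ has entries $[C_M(\mathbf y)]_{k\alpha}=\psi_k(y_\alpha)$. $P_{I_M}$ denotes the orthogonal projection of $L^2(\Omega)$ onto $H_M$. The reference field is $p_r^{I_M}(x,t)=\sum_{k=1}^{N_M}(\boldsymbol p_r(t))_k\psi_k(x)$. The field $p$ is the solution of the point-actuated wave equation $c_0^{-2}\partial_t^2p-\Delta p=\sum_{\alpha=1}^Nq_\alpha(t)\delta_{y_\alpha}$ in $\Omega\times(0,T)$, $p=0$ on $\partial\Omega$, $p(\cdot,0)=\partial_tp(\cdot,0)=0$, driven by $\mathbf q=\mathbf q^{\mathrm{ideal}}$. This equation is interpreted only after projection on $H_M$ (Galerkin sense): $P_{I_M}p(\cdot,t)=p_M(\cdot,t)=\sum_{k=1}^{N_M}(\boldsymbol p^M(t))_k\psi_k\in H_M$ satisfies, for a.e. $t$ and all $\varphi\in H_M$, $c_0^{-2}\langle\partial_t^2p_M,\varphi\rangle+\langle\nabla p_M,\nabla\varphi\rangle=\sum_{\alpha=1}^Nq_\alpha(t)\varphi(y_\alpha)$,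 with zero initial data. *)

theory Defs
  imports "HOL-Analysis.Analysis"
begin

subsection \<open>Domains of class $C^{1,1}$\<close>

definition C11_function :: "(real^2 \<Rightarrow> real) \<Rightarrow> bool" where
  "C11_function \<gamma> \<longleftrightarrow>
     (\<exists>\<gamma>' K. (\<forall>z. (\<gamma> has_derivative (\<lambda>h. \<gamma>' z \<bullet> h)) (at z)) \<and> K-lipschitz_on UNIV (\<gamma>' :: real^2 \<Rightarrow> real^2))"

text \<open>Near each boundary point the set is, in rotated Cartesian coordinates, the part of a ball
  above the graph of a $C^{1,1}$ function.\<close>

definition bounded_C11_domain :: "(real^3) set \<Rightarrow> bool" where
  "bounded_C11_domain \<Omega> \<longleftrightarrow>
     \<Omega> \<noteq> {} \<and> open \<Omega> \<and> connected \<Omega> \<and> bounded \<Omega> \<and>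
     (\<forall>x0\<in>frontier \<Omega>. \<exists>r>0. \<exists>(Q :: real^3 \<Rightarrow> real^3) \<gamma>. orthogonal_transformation Q \<and> C11_function \<gamma> \<and>
        \<Omega> \<inter> ball x0 r = {x \<in> ball x0 r. \<gamma> (vector [Q x $ 1, Q x $ 2]) < Q x $ 3})"

subsection \<open>The space $L^2$ and orthogonal projections\<close>

text \<open>Elements of $L^2(\Omega)$ are represented by functions on the whole space, of which only the
  values on \<open>\<Omega>\<close> matter.\<close>

definition square_integrable :: "(real^3) set \<Rightarrow> (real^3 \<Rightarrow> real) \<Rightarrow> bool" where
  "square_integrable \<Omega> u \<longleftrightarrow>
     set_borel_measurable lebesgue \<Omega> u \<and> set_integrable lebesgue \<Omega> (\<lambda>x. (u x)\<^sup>2)"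

definition l2_inner :: "(real^3) set \<Rightarrow> (real^3 \<Rightarrow> real) \<Rightarrow> (real^3 \<Rightarrow> real) \<Rightarrow> real" where
  "l2_inner \<Omega> u v = (LINT x:\<Omega>|lebesgue. u x * v x)"

definition l2_dist_sq :: "(real^3) set \<Rightarrow> (real^3 \<Rightarrow> real) \<Rightarrow> (real^3 \<Rightarrow> real) \<Rightarrow> real" where
  "l2_dist_sq \<Omega> u v = (LINT x:\<Omega>|lebesgue. (u x - v x)\<^sup>2)"

text \<open>The description operator is harmless for the spaces \<open>V\<close> used below (spans of finitely many
  \<open>L\<^sup>2\<close>-orthonormal functions): they contain exactly one such \<open>w\<close>, as a function.\<close>

definition orth_proj ::
  "(real^3) set \<Rightarrow> (real^3 \<Rightarrow> real) set \<Rightarrow> (real^3 \<Rightarrow> real) \<Rightarrow> real^3 \<Rightarrow> real" where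
  "orth_proj \<Omega> V u = (THE w. w \<in> V \<and> (\<forall>\<phi>\<in>V. l2_inner \<Omega> (\<lambda>x. u x - w x) \<phi> = 0))"

text \<open>The extension of the orthogonal projection to functionals \<open>F\<close> acting at least on \<open>V\<close>; a function
  \<open>u\<close> in \<open>L\<^sup>2\<close> corresponds to the functional \<open>l2_inner \<Omega> u\<close>.\<close>

definition orth_proj_functional ::
  "(real^3) set \<Rightarrow> (real^3 \<Rightarrow> real) set \<Rightarrow> ((real^3 \<Rightarrow> real) \<Rightarrow> real) \<Rightarrow> real^3 \<Rightarrow> real" where
  "orth_proj_functional \<Omega> V F = (THE w. w \<in> V \<and> (\<forall>\<phi>\<in>V. l2_inner \<Omega> w \<phi> = F \<phi>))"

subsection \<open>The Dirichlet Laplacian\<close>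

definition partial_deriv :: "3 \<Rightarrow> (real^3 \<Rightarrow> real) \<Rightarrow> real^3 \<Rightarrow> real" where
  "partial_deriv i f x = frechet_derivative f (at x) (axis i 1)"

primrec Ck_space :: "nat \<Rightarrow> (real^3 \<Rightarrow> real) \<Rightarrow> bool" where
  "Ck_space 0 f \<longleftrightarrow> continuous_on UNIV f"
| "Ck_space (Suc k) f \<longleftrightarrow>
     (\<forall>x. f differentiable (at x)) \<and> (\<forall>i. Ck_space k (partial_deriv i f))"

definition test_function :: "(real^3) set \<Rightarrow> (real^3 \<Rightarrow> real) \<Rightarrow> bool" where
  "test_function \<Omega> \<phi> \<longleftrightarrow>
     (\<forall>k. Ck_space k \<phi>) \<and> (\<exists>K. compact K \<and> K \<subseteq> \<Omega> \<and> (\<forall>x. x \<notin> K \<longrightarrow> \<phi> x = 0))"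

definition has_weak_gradient ::
  "(real^3) set \<Rightarrow> (real^3 \<Rightarrow> real) \<Rightarrow> (real^3 \<Rightarrow> real^3) \<Rightarrow> bool" where
  "has_weak_gradient \<Omega> u g \<longleftrightarrow>
     square_integrable \<Omega> u \<and> (\<forall>i. square_integrable \<Omega> (\<lambda>x. g x $ i)) \<and>
     (\<forall>\<phi> i. test_function \<Omega> \<phi> \<longrightarrow>
        l2_inner \<Omega> u (partial_deriv i \<phi>) = - l2_inner \<Omega> (\<lambda>x. g x $ i) \<phi>)"

text \<open>\<open>H10 \<Omega>\<close> is the closure of the test functions in the Sobolev space \<open>H\<^sup>1\<close>.\<close>

definition H10 :: "(real^3) set \<Rightarrow> (real^3 \<Rightarrow> real) set" where
  "H10 \<Omega> = {u. \<exists>g. has_weak_gradient \<Omega> u g \<and>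
     (\<exists>\<phi>. (\<forall>n. test_function \<Omega> (\<phi> n)) \<and>
        (\<lambda>n. l2_dist_sq \<Omega> (\<phi> n) u) \<longlonglongrightarrow> 0 \<and>
        (\<forall>i. (\<lambda>n. l2_dist_sq \<Omega> (partial_deriv i (\<phi> n)) (\<lambda>x. g x $ i)) \<longlonglongrightarrow> 0))}"

text \<open>Weak gradients are unique up to null sets, so that the choice does not affect integrals.\<close>

definition weak_grad :: "(real^3) set \<Rightarrow> (real^3 \<Rightarrow> real) \<Rightarrow> real^3 \<Rightarrow> real^3" where
  "weak_grad \<Omega> u = (SOME g. has_weak_gradient \<Omega> u g)"

definition dirichlet_form :: "(real^3) set \<Rightarrow> (real^3 \<Rightarrow> real) \<Rightarrow> (real^3 \<Rightarrow> real) \<Rightarrow> real" where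
  "dirichlet_form \<Omega> u v = (LINT x:\<Omega>|lebesgue. weak_grad \<Omega> u x \<bullet> weak_grad \<Omega> v x)"

text \<open>The graph of \<open>-\<Delta>\<^sub>D\<close>, the operator in \<open>L\<^sup>2\<close> associated with the Dirichlet form on \<open>H10 \<Omega>\<close>.\<close>

definition neg_dirichlet_laplacian ::
  "(real^3) set \<Rightarrow> (real^3 \<Rightarrow> real) \<Rightarrow> (real^3 \<Rightarrow> real) \<Rightarrow> bool" where
  "neg_dirichlet_laplacian \<Omega> u f \<longleftrightarrow>
     u \<in> H10 \<Omega> \<and> square_integrable \<Omega> f \<and> (\<forall>v\<in>H10 \<Omega>. dirichlet_form \<Omega> u v = l2_inner \<Omega> f v)"

text \<open>The continuous representative is required because eigenfunctions are evaluated at points.\<close>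

definition dirichlet_eigenfunction :: "(real^3) set \<Rightarrow> real \<Rightarrow> (real^3 \<Rightarrow> real) \<Rightarrow> bool" where
  "dirichlet_eigenfunction \<Omega> \<mu> u \<longleftrightarrow>
     neg_dirichlet_laplacian \<Omega> u (\<lambda>x. \<mu> * u x) \<and> continuous_on \<Omega> u \<and> (\<exists>x\<in>\<Omega>. u x \<noteq> 0)"

subsection \<open>Modal quantities\<close>

definition modal_field :: "('m::finite \<Rightarrow> real^3 \<Rightarrow> real) \<Rightarrow> real^'m \<Rightarrow> real^3 \<Rightarrow> real" where
  "modal_field \<psi> a x = (\<Sum>k\<in>UNIV. a $ k * \<psi> k x)"

definition modal_space :: "('m::finite \<Rightarrow> real^3 \<Rightarrow> real) \<Rightarrow> (real^3 \<Rightarrow> real) set" where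
  "modal_space \<psi> = range (modal_field \<psi>)"

definition modal_frequency :: "real \<Rightarrow> ('m \<Rightarrow> real) \<Rightarrow> 'm \<Rightarrow> real" where
  "modal_frequency c0 ev k = c0 * sqrt (ev k)"

definition modal_stiffness :: "real \<Rightarrow> ('m::finite \<Rightarrow> real) \<Rightarrow> real^'m^'m" where
  "modal_stiffness c0 ev = (\<chi> j k. if j = k then (modal_frequency c0 ev k)\<^sup>2 else 0)"

definition control_matrix ::
  "('m::finite \<Rightarrow> real^3 \<Rightarrow> real) \<Rightarrow> ('n::finite \<Rightarrow> real^3) \<Rightarrow> real^'n^'m" where
  "control_matrix \<psi> y = (\<chi> k \<alpha>. \<psi> k (y \<alpha>))"

subsection \<open>Dynamics on the time interval $[0,T]$\<close>

text \<open>One-sided derivatives at the endpoints.\<close>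

definition time_deriv :: "real \<Rightarrow> (real \<Rightarrow> 'a::real_normed_vector) \<Rightarrow> real \<Rightarrow> 'a" where
  "time_deriv T f t = vector_derivative f (at t within {0..T})"

primrec Ck_time :: "nat \<Rightarrow> real \<Rightarrow> (real \<Rightarrow> 'a::real_normed_vector) \<Rightarrow> bool" where
  "Ck_time 0 T f \<longleftrightarrow> continuous_on {0..T} f"
| "Ck_time (Suc k) T f \<longleftrightarrow>
     (\<forall>t\<in>{0..T}. f differentiable (at t within {0..T})) \<and> Ck_time k T (time_deriv T f)"

definition q_ideal ::
  "real \<Rightarrow> real \<Rightarrow> ('m::finite \<Rightarrow> real) \<Rightarrow> real^'m^'n::finite \<Rightarrow> (real \<Rightarrow> real^'m) \<Rightarrow> real \<Rightarrow> real^'n" where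
  "q_ideal c0 T ev L pr t =
     (1 / c0\<^sup>2) *\<^sub>R (L *v (time_deriv T (time_deriv T pr) t + modal_stiffness c0 ev *v pr t))"

definition modal_solution ::
  "real \<Rightarrow> real \<Rightarrow> ('m::finite \<Rightarrow> real) \<Rightarrow> real^'n::finite^'m \<Rightarrow> (real \<Rightarrow> real^'n) \<Rightarrow> (real \<Rightarrow> real^'m) \<Rightarrow> bool" where
  "modal_solution c0 T ev C q a \<longleftrightarrow>
     Ck_time 2 T a \<and> a 0 = 0 \<and> time_deriv T a 0 = 0 \<and>
     (\<forall>t\<in>{0..T}. time_deriv T (time_deriv T a) t + modal_stiffness c0 ev *v a t
                   = c0\<^sup>2 *\<^sub>R (C *v q t))"

text \<open>The Galerkin equations for \<open>p\<^sub>M(t) = modal_field \<psi> (a t)\<close>.  As the equation holds for almost every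
  \<open>t\<close> only, the first time derivative is merely required to be absolutely continuous; \<open>a2\<close> is the
  second derivative of the coefficients.\<close>

definition galerkin_solution ::
  "(real^3) set \<Rightarrow> real \<Rightarrow> real \<Rightarrow> ('m::finite \<Rightarrow> real^3 \<Rightarrow> real) \<Rightarrow> ('n::finite \<Rightarrow> real^3) \<Rightarrow>
     (real \<Rightarrow> real^'n) \<Rightarrow> (real \<Rightarrow> real^'m) \<Rightarrow> bool" where
  "galerkin_solution \<Omega> c0 T \<psi> y q a \<longleftrightarrow>
     a 0 = 0 \<and> time_deriv T a 0 = 0 \<and>
     (\<exists>a2. a2 absolutely_integrable_on {0..T} \<and>
        (\<forall>t\<in>{0..T}. (a has_vector_derivative (time_deriv T a 0 + integral {0..t} a2))
                        (at t within {0..T})) \<and>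
        (AE t in lebesgue. t \<in> {0..T} \<longrightarrow> (\<forall>\<phi>\<in>modal_space \<psi>.
           1 / c0\<^sup>2 * l2_inner \<Omega> (modal_field \<psi> (a2 t)) \<phi> + dirichlet_form \<Omega> (modal_field \<psi> (a t)) \<phi>
             = (\<Sum>\<alpha>\<in>UNIV. q t $ \<alpha> * \<phi> (y \<alpha>)))))"

text \<open>The point-actuated wave equation, with homogeneous initial and boundary data, is only given a
  meaning after projection onto the modal space.\<close>

definition point_actuated_field ::
  "(real^3) set \<Rightarrow> real \<Rightarrow> real \<Rightarrow> ('m::finite \<Rightarrow> real^3 \<Rightarrow> real) \<Rightarrow> ('n::finite \<Rightarrow> real^3) \<Rightarrow>
     (real \<Rightarrow> real^'n) \<Rightarrow> (real \<Rightarrow> real^3 \<Rightarrow> real) \<Rightarrow> bool" where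
  "point_actuated_field \<Omega> c0 T \<psi> y q p \<longleftrightarrow>
     (\<forall>t\<in>{0..T}. square_integrable \<Omega> (p t)) \<and>
     (\<exists>a. galerkin_solution \<Omega> c0 T \<psi> y q a \<and>
        (\<forall>t\<in>{0..T}. orth_proj \<Omega> (modal_space \<psi>) (p t) = modal_field \<psi> (a t)))"

text \<open>The time derivative of a field as a functional on spatial test functions, through
  $\langle \partial_t p(t), \varphi\rangle = \frac{d}{dt} \langle p(t), \varphi\rangle$.  A field driven by
  point sources with $q(0) \neq 0$ need not have a time derivative with values in $L^2$.\<close>

definition field_deriv_functional ::
  "(real^3) set \<Rightarrow> real \<Rightarrow> (real \<Rightarrow> real^3 \<Rightarrow> real) \<Rightarrow> real \<Rightarrow> (real^3 \<Rightarrow> real) \<Rightarrow> real" where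
  "field_deriv_functional \<Omega> T p t \<phi> = time_deriv T (\<lambda>s. l2_inner \<Omega> (p s) \<phi>) t"

definition has_weak_L2_time_deriv ::
  "(real^3) set \<Rightarrow> real \<Rightarrow> (real \<Rightarrow> real^3 \<Rightarrow> real) \<Rightarrow> real \<Rightarrow> (real^3 \<Rightarrow> real) \<Rightarrow> bool" where
  "has_weak_L2_time_deriv \<Omega> T p t v \<longleftrightarrow>
     square_integrable \<Omega> v \<and>
     (\<forall>\<phi>. square_integrable \<Omega> \<phi> \<longrightarrow>
        ((\<lambda>s. l2_inner \<Omega> (p s) \<phi>) has_real_derivative l2_inner \<Omega> v \<phi>) (at t within {0..T}))"

end

theory Submission
  imports Defs
begin

text \<open>Everything is read off modal coordinates. Testing the Galerkin equation with \<open>\<psi> k\<close> and moving the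
  Dirichlet form onto the eigenfunction turns it into the modal equations almost everywhere. Since the
  ideal input is continuous, the coefficients then solve them classically. As \<open>C ** L = mat 1\<close>, the ideal
  input is exactly the one for which the reference coefficients solve the modal equations, and these
  have only one solution because the energy of the difference of two solutions is conserved.\<close>

subsection \<open>Square integrable functions\<close>

text \<open>The indicator is idempotent, so the truncated product is the product of the truncated
  functions and hence measurable; it is dominated by
  \<open>(u x)\<^sup>2 + (v x)\<^sup>2\<close>.\<close>

lemma square_integrable_mult:
  assumes "square_integrable \<Omega> u" "square_integrable \<Omega> v"
  shows "set_integrable lebesgue \<Omega> (\<lambda>x. u x * v x)"
proof -
  have "(\<lambda>x. (indicator \<Omega> x *\<^sub>R u x) * (indicator \<Omega> x *\<^sub>R v x)) \<in> borel_measurable lebesgue"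
    using assms unfolding square_integrable_def set_borel_measurable_def
    by (intro borel_measurable_times) auto
  moreover have "(\<lambda>x. (indicator \<Omega> x *\<^sub>R u x) * (indicator \<Omega> x *\<^sub>R v x))
      = (\<lambda>x. indicator \<Omega> x *\<^sub>R (u x * v x))"
    by (auto simp: indicator_def)
  ultimately have m: "(\<lambda>x. indicator \<Omega> x *\<^sub>R (u x * v x)) \<in> borel_measurable lebesgue"
    by simp
  have i: "integrable lebesgue
      (\<lambda>x. indicator \<Omega> x *\<^sub>R (u x)\<^sup>2 + indicator \<Omega> x *\<^sub>R (v x)\<^sup>2)"
    using assms unfolding square_integrable_def set_integrable_def
    by (intro Bochner_Integration.integrable_add) auto
  have ab: "\<bar>a * b\<bar> \<le> a\<^sup>2 + b\<^sup>2" for a b :: real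
  proof -
    have "2 * (\<bar>a\<bar> * \<bar>b\<bar>) \<le> a\<^sup>2 + b\<^sup>2"
      using sum_squares_bound[of "\<bar>a\<bar>" "\<bar>b\<bar>"] by simp
    moreover have "0 \<le> \<bar>a\<bar> * \<bar>b\<bar>" by simp
    ultimately show ?thesis unfolding abs_mult by linarith
  qed
  show ?thesis unfolding set_integrable_def
    by (rule Bochner_Integration.integrable_bound[OF i])
       (use m in \<open>simp_all add: indicator_def ab\<close>)
qed

text \<open>The single operation \<open>c * u x + v x\<close> covers sums, differences and
  multiples; closure under it is what the induction over modes uses later.\<close>

lemma square_integrable_scale_add:
  assumes "square_integrable \<Omega> u" "square_integrable \<Omega> v"
  shows "square_integrable \<Omega> (\<lambda>x. c * u x + v x)"
proof -
  have "(\<lambda>x. c * (indicator \<Omega> x *\<^sub>R u x) + indicator \<Omega> x *\<^sub>R v x) \<in> borel_measurable lebesgue"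
    using assms unfolding square_integrable_def set_borel_measurable_def
    by (intro borel_measurable_add borel_measurable_times) auto
  then have "set_borel_measurable lebesgue \<Omega> (\<lambda>x. c * u x + v x)"
    unfolding set_borel_measurable_def by (simp add: algebra_simps)
  \<comment> \<open>This is the expanded square, written with products that are already known to be
    integrable.\<close>
  moreover have "set_integrable lebesgue \<Omega>
      (\<lambda>x. c\<^sup>2 * (u x * u x) + ((2 * c) * (u x * v x) + v x * v x))"
    using assms by (intro set_integral_add(1) set_integrable_mult_right square_integrable_mult)
  then have "set_integrable lebesgue \<Omega> (\<lambda>x. (c * u x + v x)\<^sup>2)"
    by (simp add: power2_eq_square algebra_simps)
  ultimately show ?thesis unfolding square_integrable_def by blast
qed

lemma square_integrable_diff:
  assumes "square_integrable \<Omega> u" "square_integrable \<Omega> v"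
  shows "square_integrable \<Omega> (\<lambda>x. u x - v x)"
  using square_integrable_scale_add[OF assms(2,1), of "-1"] by simp

text \<open>Since \<open>f\<close> vanishes off \<open>K\<close>, the indicator of
  \<open>\<Omega>\<close> may be exchanged for that of the compact set \<open>K\<close>, over which
  a continuous function is integrable.\<close>

lemma square_integrable_compact_support:
  assumes "continuous_on UNIV f" "compact K" "K \<subseteq> \<Omega>" "\<forall>x. x \<notin> K \<longrightarrow> f x = 0"
  shows "square_integrable \<Omega> f"
proof -
  have "f \<in> borel_measurable lborel"
    using borel_measurable_continuous_onI[OF assms(1)] by simp
  then have "f \<in> borel_measurable lebesgue"
    by (rule measurable_completion)
  moreover have "(\<lambda>x. indicator \<Omega> x *\<^sub>R f x) = f"
    using assms(3,4) by (fastforce simp: indicator_def fun_eq_iff)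
  ultimately have "set_borel_measurable lebesgue \<Omega> f"
    unfolding set_borel_measurable_def by simp
  moreover have "integrable lborel (\<lambda>x. indicator K x *\<^sub>R (f x)\<^sup>2)"
    by (intro borel_integrable_compact assms(2) continuous_intros continuous_on_subset[OF assms(1)]) auto
  then have "integrable lebesgue (\<lambda>x. indicator K x *\<^sub>R (f x)\<^sup>2)"
    by (subst integrable_completion) auto
  moreover have "(\<lambda>x. indicator K x *\<^sub>R (f x)\<^sup>2) = (\<lambda>x. indicator \<Omega> x *\<^sub>R (f x)\<^sup>2)"
    using assms(3,4) by (fastforce simp: indicator_def fun_eq_iff)
  ultimately show ?thesis
    unfolding square_integrable_def set_integrable_def by simp
qed

section \<open>Symmetry and linearity of the two forms\<close>

lemma l2_inner_commute: "l2_inner \<Omega> u v = l2_inner \<Omega> v u"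
  by (simp add: l2_inner_def mult.commute)

lemma dirichlet_form_commute: "dirichlet_form \<Omega> u v = dirichlet_form \<Omega> v u"
  by (simp add: dirichlet_form_def inner_commute)

lemma l2_inner_mult_left: "l2_inner \<Omega> (\<lambda>x. c * u x) v = c * l2_inner \<Omega> u v"
  by (simp add: l2_inner_def mult.assoc)

lemma l2_inner_add_left:
  assumes "square_integrable \<Omega> u" "square_integrable \<Omega> v" "square_integrable \<Omega> w"
  shows "l2_inner \<Omega> (\<lambda>x. u x + v x) w = l2_inner \<Omega> u w + l2_inner \<Omega> v w"
  using set_integral_add(2)[OF square_integrable_mult[OF assms(1,3)] square_integrable_mult[OF assms(2,3)]]
  by (simp add: l2_inner_def distrib_right)

lemma l2_inner_diff_left:
  assumes "square_integrable \<Omega> u" "square_integrable \<Omega> v" "square_integrable \<Omega> w"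
  shows "l2_inner \<Omega> (\<lambda>x. u x - v x) w = l2_inner \<Omega> u w - l2_inner \<Omega> v w"
  using set_integral_diff(2)[OF square_integrable_mult[OF assms(1,3)] square_integrable_mult[OF assms(2,3)]]
  by (simp add: l2_inner_def left_diff_distrib)

lemma l2_inner_scale_add_left:
  assumes "square_integrable \<Omega> u" "square_integrable \<Omega> v" "square_integrable \<Omega> w"
  shows "l2_inner \<Omega> (\<lambda>x. c * u x + v x) w = c * l2_inner \<Omega> u w + l2_inner \<Omega> v w"
proof -
  \<comment> \<open>The multiple \<open>c * u x\<close> is \<open>(c - 1) * u x + u x\<close>, a
    combination of the available shape.\<close>
  have "square_integrable \<Omega> (\<lambda>x. c * u x)"
    using square_integrable_scale_add[OF assms(1) assms(1), of "c - 1"]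
    by (simp add: algebra_simps)
  then show ?thesis
    using l2_inner_add_left[OF _ assms(2,3)] by (simp add: l2_inner_mult_left)
qed

section \<open>Convergence in squared distance\<close>

lemma l2_dist_sq_nonneg: "0 \<le> l2_dist_sq \<Omega> u v"
  unfolding l2_dist_sq_def set_lebesgue_integral_def
  by (intro Bochner_Integration.integral_nonneg) (auto simp: indicator_def)

text \<open>Squared distances obey no triangle inequality; this bound up to constants replaces it
  and suffices for limits equal to zero.\<close>

lemma l2_dist_sq_scale_add_le:
  assumes "square_integrable \<Omega> u" "square_integrable \<Omega> v"
    and "square_integrable \<Omega> u'" "square_integrable \<Omega> v'"
  shows "l2_dist_sq \<Omega> (\<lambda>x. c * u x + v x) (\<lambda>x. c * u' x + v' x)
     \<le> 2 * c\<^sup>2 * l2_dist_sq \<Omega> u u' + 2 * l2_dist_sq \<Omega> v v'"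
proof -
  note d = square_integrable_diff[OF assms(1,3)] square_integrable_diff[OF assms(2,4)]
    square_integrable_diff[OF square_integrable_scale_add[OF assms(1,2), of c]
      square_integrable_scale_add[OF assms(3,4), of c]]
  note i = d[unfolded square_integrable_def, THEN conjunct2]
  have "l2_dist_sq \<Omega> (\<lambda>x. c * u x + v x) (\<lambda>x. c * u' x + v' x)
      \<le> (LINT x:\<Omega>|lebesgue. (2 * c\<^sup>2) * (u x - u' x)\<^sup>2 + 2 * (v x - v' x)\<^sup>2)"
    unfolding l2_dist_sq_def
  proof (rule set_integral_mono)
    show "set_integrable lebesgue \<Omega> (\<lambda>x. (2 * c\<^sup>2) * (u x - u' x)\<^sup>2 + 2 * (v x - v' x)\<^sup>2)"
      using i by (intro set_integral_add(1) set_integrable_mult_right)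
    fix x
    \<comment> \<open>The right side exceeds the left by exactly
      \<open>(c * a - b)\<^sup>2\<close>.\<close>
    have "(c * a + b)\<^sup>2 \<le> 2 * c\<^sup>2 * a\<^sup>2 + 2 * b\<^sup>2" for a b :: real
      using zero_le_power2[of "c * a - b"] by (simp add: power2_eq_square algebra_simps)
    from this[of "u x - u' x" "v x - v' x"]
    show "(c * u x + v x - (c * u' x + v' x))\<^sup>2 \<le> 2 * c\<^sup>2 * (u x - u' x)\<^sup>2 + 2 * (v x - v' x)\<^sup>2"
      by (simp add: algebra_simps)
  qed (use i in auto)
  also have "\<dots> = 2 * c\<^sup>2 * l2_dist_sq \<Omega> u u' + 2 * l2_dist_sq \<Omega> v v'"
    unfolding l2_dist_sq_def using i by (subst set_integral_add(2)) auto
  finally show ?thesis .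
qed

lemma l2_dist_sq_scale_add_tendsto:
  assumes "\<And>n. square_integrable \<Omega> (f n)" "\<And>n. square_integrable \<Omega> (g n)"
    and "square_integrable \<Omega> u" "square_integrable \<Omega> v"
    and "(\<lambda>n. l2_dist_sq \<Omega> (f n) u) \<longlonglongrightarrow> 0" "(\<lambda>n. l2_dist_sq \<Omega> (g n) v) \<longlonglongrightarrow> 0"
  shows "(\<lambda>n. l2_dist_sq \<Omega> (\<lambda>x. c * f n x + g n x) (\<lambda>x. c * u x + v x)) \<longlonglongrightarrow> 0"
proof (rule tendsto_sandwich[OF _ _ tendsto_const])
  show "\<forall>\<^sub>F n in sequentially. l2_dist_sq \<Omega> (\<lambda>x. c * f n x + g n x) (\<lambda>x. c * u x + v x)
      \<le> 2 * c\<^sup>2 * l2_dist_sq \<Omega> (f n) u + 2 * l2_dist_sq \<Omega> (g n) v"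
    by (intro always_eventually allI l2_dist_sq_scale_add_le assms)
  show "(\<lambda>n. 2 * c\<^sup>2 * l2_dist_sq \<Omega> (f n) u + 2 * l2_dist_sq \<Omega> (g n) v) \<longlonglongrightarrow> 0"
    using tendsto_add[OF tendsto_mult_left[OF assms(5), of "2 * c\<^sup>2"] tendsto_mult_left[OF assms(6), of 2]]
    by simp
qed (simp add: l2_dist_sq_nonneg)

subsection \<open>The space \<open>H10\<close> is closed under linear combinations\<close>

text \<open>\<open>frechet_derivative\<close> is a choice that is meaningful only where a derivative
  exists, so both functions are assumed differentiable before linearity is used.\<close>

lemma partial_deriv_scale_add:
  assumes "\<And>x. f differentiable (at x)" "\<And>x. g differentiable (at x)"
  shows "partial_deriv i (\<lambda>x. c * f x + g x) = (\<lambda>x. c * partial_deriv i f x + partial_deriv i g x)"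
proof
  fix x
  have "((\<lambda>x. c * f x + g x) has_derivative
      (\<lambda>h. c * frechet_derivative f (at x) h + frechet_derivative g (at x) h)) (at x)"
    using assms[of x] by (auto intro!: derivative_eq_intros simp: frechet_derivative_works)
  from frechet_derivative_at[OF this]
  show "partial_deriv i (\<lambda>x. c * f x + g x) x = c * partial_deriv i f x + partial_deriv i g x"
    unfolding partial_deriv_def by metis
qed

text \<open>In the inductive step the partial derivatives of the combination are combinations of
  partial derivatives, so the hypothesis has to be available for other functions than
  \<open>f\<close> and \<open>g\<close>.\<close>

lemma Ck_space_scale_add:
  "Ck_space k f \<Longrightarrow> Ck_space k g \<Longrightarrow> Ck_space k (\<lambda>x. c * f x + g x)"
proof (induction k arbitrary: f g)
  case 0
  then show ?case by (simp add: continuous_on_add continuous_on_mult_left)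
next
  case (Suc k)
  then show ?case
    by (simp add: partial_deriv_scale_add)
qed

lemma test_function_Ck_space: "test_function \<Omega> f \<Longrightarrow> Ck_space k f"
  by (simp add: test_function_def)

lemma test_function_support:
  assumes "test_function \<Omega> f"
  obtains K where "compact K" "K \<subseteq> \<Omega>" "\<forall>x. x \<notin> K \<longrightarrow> f x = 0"
  using assms unfolding test_function_def by auto

lemma test_function_scale_add:
  assumes "test_function \<Omega> f" "test_function \<Omega> g"
  shows "test_function \<Omega> (\<lambda>x. c * f x + g x)"
proof -
  obtain K where K: "compact K" "K \<subseteq> \<Omega>" "\<forall>x. x \<notin> K \<longrightarrow> f x = 0"
    using test_function_support[OF assms(1)] .
  obtain K' where K': "compact K'" "K' \<subseteq> \<Omega>" "\<forall>x. x \<notin> K' \<longrightarrow> g x = 0"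
    using test_function_support[OF assms(2)] .
  show ?thesis
    unfolding test_function_def
  proof (intro conjI allI exI[of _ "K \<union> K'"] impI)
    show "Ck_space k (\<lambda>x. c * f x + g x)" for k
      using assms by (intro Ck_space_scale_add test_function_Ck_space)
  qed (use K K' in auto)
qed

lemma test_function_differentiable: "test_function \<Omega> f \<Longrightarrow> f differentiable (at x)"
  using test_function_Ck_space[of \<Omega> f "Suc 0"] by simp

lemma square_integrable_test_function:
  assumes "test_function \<Omega> f"
  shows "square_integrable \<Omega> f"
proof -
  obtain K where K: "compact K" "K \<subseteq> \<Omega>" "\<forall>x. x \<notin> K \<longrightarrow> f x = 0"
    using test_function_support[OF assms] .
  have "continuous_on UNIV f"
    using test_function_Ck_space[OF assms, of 0] by simp
  then show ?thesis
    using K by (rule square_integrable_compact_support)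
qed

text \<open>The complement of \<open>K\<close> is open and \<open>f\<close> is zero on it, so the
  derivative vanishes there too and \<open>K\<close> also supports the partial derivative.\<close>

lemma square_integrable_partial_deriv:
  assumes "test_function \<Omega> f"
  shows "square_integrable \<Omega> (partial_deriv i f)"
proof -
  have cont: "continuous_on UNIV (partial_deriv i f)"
    using test_function_Ck_space[OF assms, of "Suc 0"] by simp
  obtain K where K: "compact K" "K \<subseteq> \<Omega>" "\<forall>x. x \<notin> K \<longrightarrow> f x = 0"
    using test_function_support[OF assms] .
  have "partial_deriv i f x = 0" if "x \<notin> K" for x
  proof -
    have "open (- K)" using K(1) by (simp add: compact_imp_closed open_Compl)
    then have "(f has_derivative (\<lambda>_. 0)) (at x)"
      using that K(3) by (intro has_derivative_transform_within_open[OF has_derivative_const, where s = "- K"]) auto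
    from frechet_derivative_at[OF this] show ?thesis
      unfolding partial_deriv_def by metis
  qed
  with cont K(1,2) show ?thesis by (intro square_integrable_compact_support) auto
qed

text \<open>The defining identity is linear in the function and its gradient jointly; test functions
  and their partial derivatives are square integrable, so the integrals split.\<close>

lemma has_weak_gradient_scale_add:
  assumes "has_weak_gradient \<Omega> u g" "has_weak_gradient \<Omega> v h"
  shows "has_weak_gradient \<Omega> (\<lambda>x. c * u x + v x) (\<lambda>x. c *\<^sub>R g x + h x)"
  using assms unfolding has_weak_gradient_def
  by (auto simp: square_integrable_scale_add l2_inner_scale_add_left
      square_integrable_partial_deriv square_integrable_test_function)

lemma H10_square_integrable: "u \<in> H10 \<Omega> \<Longrightarrow> square_integrable \<Omega> u"
  unfolding H10_def has_weak_gradient_def by blast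

text \<open>The approximating test functions are combined with the same coefficient as the limits,
  and so are the weak gradients.\<close>

lemma H10_scale_add:
  assumes "u \<in> H10 \<Omega>" "v \<in> H10 \<Omega>"
  shows "(\<lambda>x. c * u x + v x) \<in> H10 \<Omega>"
proof -
  obtain g f where u: "has_weak_gradient \<Omega> u g" "\<And>n. test_function \<Omega> (f n)"
      "(\<lambda>n. l2_dist_sq \<Omega> (f n) u) \<longlonglongrightarrow> 0"
      "\<And>i. (\<lambda>n. l2_dist_sq \<Omega> (partial_deriv i (f n)) (\<lambda>x. g x $ i)) \<longlonglongrightarrow> 0"
    using assms(1) unfolding H10_def by blast
  obtain h f' where v: "has_weak_gradient \<Omega> v h" "\<And>n. test_function \<Omega> (f' n)"
      "(\<lambda>n. l2_dist_sq \<Omega> (f' n) v) \<longlonglongrightarrow> 0"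
      "\<And>i. (\<lambda>n. l2_dist_sq \<Omega> (partial_deriv i (f' n)) (\<lambda>x. h x $ i)) \<longlonglongrightarrow> 0"
    using assms(2) unfolding H10_def by blast
  have "(\<lambda>n. l2_dist_sq \<Omega> (partial_deriv i (\<lambda>x. c * f n x + f' n x))
      (\<lambda>x. (c *\<^sub>R g x + h x) $ i)) \<longlonglongrightarrow> 0" for i
  proof -
    have "partial_deriv i (\<lambda>x. c * f n x + f' n x)
        = (\<lambda>x. c * partial_deriv i (f n) x + partial_deriv i (f' n) x)" for n
      by (intro partial_deriv_scale_add test_function_differentiable[OF u(2)]
          test_function_differentiable[OF v(2)])
    moreover have "(\<lambda>n. l2_dist_sq \<Omega> (\<lambda>x. c * partial_deriv i (f n) x + partial_deriv i (f' n) x)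
        (\<lambda>x. c * g x $ i + h x $ i)) \<longlonglongrightarrow> 0"
      using u(1) v(1) unfolding has_weak_gradient_def
      by (intro l2_dist_sq_scale_add_tendsto square_integrable_partial_deriv u(2,4) v(2,4)) auto
    ultimately show ?thesis by simp
  qed
  moreover have "(\<lambda>n. l2_dist_sq \<Omega> (\<lambda>x. c * f n x + f' n x) (\<lambda>x. c * u x + v x)) \<longlonglongrightarrow> 0"
    using assms u(2,3) v(2,3)
    by (intro l2_dist_sq_scale_add_tendsto) (auto simp: H10_square_integrable square_integrable_test_function)
  ultimately show ?thesis
    unfolding H10_def
    by (intro CollectI exI[of _ "\<lambda>x. c *\<^sub>R g x + h x"] exI[of _ "\<lambda>n x. c * f n x + f' n x"] conjI allI
        has_weak_gradient_scale_add[OF u(1) v(1)] test_function_scale_add[OF u(2) v(2)])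
qed

text \<open>One induction over the modes, stated for any property \<open>S\<close>; it serves both
  square integrability and membership in \<open>H10\<close>.\<close>

lemma modal_field_closed:
  assumes "\<And>k. S (\<psi> k)" "\<And>c u v. S u \<Longrightarrow> S v \<Longrightarrow> S (\<lambda>x. c * u x + v x)"
  shows "S (modal_field \<psi> a)"
proof -
  have "S (\<lambda>x. \<Sum>k\<in>A. a $ k * \<psi> k x)" if "finite A" for A
    using that
  proof (induction A)
    case empty
    \<comment> \<open>The empty sum is the zero function, obtained by subtracting an arbitrary mode
      from itself.\<close>
    show ?case using assms(2)[OF assms(1)[of undefined] assms(1)[of undefined], of "- 1"] by simp
  next
    case (insert k A)
    then show ?case using assms(2)[OF assms(1)[of k] insert.IH, of "a $ k"] by simp
  qed
  then show ?thesis unfolding modal_field_def by simp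
qed

subsection \<open>Orthonormal modes\<close>

locale orthonormal_modes =
  fixes \<Omega> :: "(real^3) set" and \<psi> :: "'m::finite \<Rightarrow> real^3 \<Rightarrow> real"
  assumes square_integrable_mode: "square_integrable \<Omega> (\<psi> k)"
    and orthonormal: "l2_inner \<Omega> (\<psi> j) (\<psi> k) = (if j = k then 1 else 0)"
begin

lemma square_integrable_modal_field: "square_integrable \<Omega> (modal_field \<psi> a)"
  by (rule modal_field_closed[where S = "square_integrable \<Omega>"])
     (simp_all add: square_integrable_mode square_integrable_scale_add)

lemma l2_inner_modal_field_right:
  assumes "square_integrable \<Omega> u"
  shows "l2_inner \<Omega> u (modal_field \<psi> b) = (\<Sum>k\<in>UNIV. b $ k * l2_inner \<Omega> u (\<psi> k))"
proof -
  have "l2_inner \<Omega> u (modal_field \<psi> b) = (LINT x:\<Omega>|lebesgue. \<Sum>k\<in>UNIV. b $ k * (u x * \<psi> k x))"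
    unfolding l2_inner_def modal_field_def by (simp add: sum_distrib_left ac_simps)
  also have "\<dots> = (\<Sum>k\<in>UNIV. LINT x:\<Omega>|lebesgue. b $ k * (u x * \<psi> k x))"
    using square_integrable_mult[OF assms square_integrable_mode]
    unfolding set_lebesgue_integral_def set_integrable_def scaleR_sum_right
    by (subst Bochner_Integration.integral_sum) (simp_all add: mult.left_commute[of "indicator _ _"])
  finally show ?thesis by (simp add: l2_inner_def)
qed

text \<open>Orthonormality leaves one term of the sum. All comparisons of modal fields below reduce
  to this recovery of coefficients.\<close>

lemma l2_inner_modal_field_mode: "l2_inner \<Omega> (modal_field \<psi> a) (\<psi> k) = a $ k"
  by (subst l2_inner_commute)
     (simp add: l2_inner_modal_field_right[OF square_integrable_mode] orthonormal if_distrib cong: if_cong)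

lemma modal_field_inject: "modal_field \<psi> a = modal_field \<psi> b \<longleftrightarrow> a = b"
  by (metis l2_inner_modal_field_mode vec_eq_iff)

lemma mode_in_modal_space: "\<psi> k \<in> modal_space \<psi>"
proof -
  have "modal_field \<psi> (axis k 1) = \<psi> k"
    by (simp add: modal_field_def fun_eq_iff axis_def if_distrib[of "\<lambda>z. z * _"] cong: if_cong)
  then show ?thesis unfolding modal_space_def by (metis rangeI)
qed

text \<open>The hypothesis says that \<open>modal_field \<psi> a\<close> represents \<open>F\<close>
  on the modal space. Any other candidate has the same pairing with every mode, hence the same
  coefficients, so the description has a unique witness.\<close>

lemma orth_proj_functional_modal_space:
  assumes "\<And>b. F (modal_field \<psi> b) = (\<Sum>k\<in>UNIV. b $ k * a $ k)"
  shows "orth_proj_functional \<Omega> (modal_space \<psi>) F = modal_field \<psi> a"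
  unfolding orth_proj_functional_def
proof (rule the_equality)
  show inner: "modal_field \<psi> a \<in> modal_space \<psi> \<and>
      (\<forall>\<phi>\<in>modal_space \<psi>. l2_inner \<Omega> (modal_field \<psi> a) \<phi> = F \<phi>)"
    unfolding modal_space_def
    by (auto simp: assms l2_inner_modal_field_right[OF square_integrable_modal_field]
        l2_inner_modal_field_mode)
  fix w assume w: "w \<in> modal_space \<psi> \<and> (\<forall>\<phi>\<in>modal_space \<psi>. l2_inner \<Omega> w \<phi> = F \<phi>)"
  then obtain b where b: "w = modal_field \<psi> b" unfolding modal_space_def by blast
  have "b $ k = a $ k" for k
    using w inner mode_in_modal_space[of k] by (metis b l2_inner_modal_field_mode)
  then have "b = a" by (simp add: vec_eq_iff)
  then show "w = modal_field \<psi> a" by (simp add: b)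
qed

text \<open>For square integrable functions, orthogonality of the residual means equality of
  pairings. The projection is thus the functional version applied to
  \<open>l2_inner \<Omega> u\<close>.\<close>

lemma orth_proj_modal_space:
  assumes "square_integrable \<Omega> u"
  shows "orth_proj \<Omega> (modal_space \<psi>) u = modal_field \<psi> (\<chi> k. l2_inner \<Omega> u (\<psi> k))"
proof -
  have "orth_proj \<Omega> (modal_space \<psi>) u = orth_proj_functional \<Omega> (modal_space \<psi>) (l2_inner \<Omega> u)"
    unfolding orth_proj_def orth_proj_functional_def
  proof (intro arg_cong[where f = The] ext conj_cong refl ball_cong)
    fix w \<phi> assume "w \<in> modal_space \<psi>" "\<phi> \<in> modal_space \<psi>"
    then have "square_integrable \<Omega> w" "square_integrable \<Omega> \<phi>"
      using square_integrable_modal_field unfolding modal_space_def by auto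
    then show "(l2_inner \<Omega> (\<lambda>x. u x - w x) \<phi> = 0) = (l2_inner \<Omega> w \<phi> = l2_inner \<Omega> u \<phi>)"
      using assms by (auto simp: l2_inner_diff_left)
  qed
  also have "\<dots> = modal_field \<psi> (\<chi> k. l2_inner \<Omega> u (\<psi> k))"
    by (rule orth_proj_functional_modal_space) (simp add: l2_inner_modal_field_right[OF assms])
  finally show ?thesis .
qed

end

text \<open>Using the symmetry of the form avoids its linearity, which would rest on the uniqueness of weak
  gradients.\<close>

lemma (in orthonormal_modes) dirichlet_form_modal_field_mode:
  assumes "\<And>k. dirichlet_eigenfunction \<Omega> (ev k) (\<psi> k)"
  shows "dirichlet_form \<Omega> (modal_field \<psi> a) (\<psi> k) = ev k * a $ k"
proof -
  have "\<psi> j \<in> H10 \<Omega>" for j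
    using assms[of j] unfolding dirichlet_eigenfunction_def neg_dirichlet_laplacian_def by blast
  \<comment> \<open>The eigenvalue identity may be tested only against elements of
    \<open>H10 \<Omega>\<close>.\<close>
  then have "modal_field \<psi> a \<in> H10 \<Omega>"
    by (rule modal_field_closed[where S = "\<lambda>u. u \<in> H10 \<Omega>"]) (auto intro: H10_scale_add)
  then have "dirichlet_form \<Omega> (\<psi> k) (modal_field \<psi> a) = l2_inner \<Omega> (\<lambda>x. ev k * \<psi> k x) (modal_field \<psi> a)"
    using assms[of k] unfolding dirichlet_eigenfunction_def neg_dirichlet_laplacian_def by blast
  then show ?thesis
    by (metis dirichlet_form_commute l2_inner_mult_left l2_inner_commute l2_inner_modal_field_mode)
qed

subsection \<open>The modal equations\<close>

text \<open>A nondegenerate interval has no isolated points, so derivatives within it are unique,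
  endpoints included.\<close>

lemma time_deriv_eqI:
  assumes "(f has_vector_derivative D) (at t within {0..T})" "T > 0" "t \<in> {0..T}"
  shows "time_deriv T f t = D"
  unfolding time_deriv_def
  using vector_derivative_within_cbox[of 0 T t f D] assms by simp

lemma Ck_time_2D:
  assumes "Ck_time 2 T f" "t \<in> {0..T}"
  shows "(f has_vector_derivative time_deriv T f t) (at t within {0..T})"
    and "(time_deriv T f has_vector_derivative time_deriv T (time_deriv T f) t) (at t within {0..T})"
  using assms unfolding time_deriv_def
  by (auto simp: numeral_2_eq_2 vector_derivative_works[symmetric] time_deriv_def[abs_def])

text \<open>Recognises classical regularity from explicit candidates \<open>f1\<close> and
  \<open>f2\<close> for the two derivatives, such as an integral and its integrand.\<close>

lemma Ck_time_2I:
  assumes "T > 0" "continuous_on {0..T} f2"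
    and f: "\<And>t. t \<in> {0..T} \<Longrightarrow> (f has_vector_derivative f1 t) (at t within {0..T})"
    and f1: "\<And>t. t \<in> {0..T} \<Longrightarrow> (f1 has_vector_derivative f2 t) (at t within {0..T})"
  shows "Ck_time 2 T f" "\<And>t. t \<in> {0..T} \<Longrightarrow> time_deriv T f t = f1 t"
    "\<And>t. t \<in> {0..T} \<Longrightarrow> time_deriv T (time_deriv T f) t = f2 t"
proof -
  show 1: "time_deriv T f t = f1 t" if "t \<in> {0..T}" for t
    using time_deriv_eqI[OF f[OF that] assms(1) that] .
  \<comment> \<open>\<open>time_deriv T f\<close> is known to agree with \<open>f1\<close> on the
    interval, which is all that a derivative within the interval sees.\<close>
  have d: "(time_deriv T f has_vector_derivative f2 t) (at t within {0..T})" if "t \<in> {0..T}" for t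
    using f1[OF that] by (rule has_vector_derivative_transform[OF that, rotated]) (simp add: 1)
  show 2: "time_deriv T (time_deriv T f) t = f2 t" if "t \<in> {0..T}" for t
    using time_deriv_eqI[OF d[OF that] assms(1) that] .
  have "continuous_on {0..T} (time_deriv T (time_deriv T f))"
    using assms(2) 2 by (subst continuous_on_cong[OF refl, of _ _ f2]) auto
  then show "Ck_time 2 T f"
    using differentiableI_vector[OF f] differentiableI_vector[OF d] by (simp add: numeral_2_eq_2)
qed

text \<open>The energy \<open>(e' s)\<^sup>2 + \<kappa> * (e s)\<^sup>2\<close> has derivative zero
  and starts at zero; as \<kappa> is positive, both squares vanish.\<close>

lemma oscillator_zero:
  fixes e e' :: "real \<Rightarrow> real"
  assumes "\<kappa> > 0" "e 0 = 0" "e' 0 = 0"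
    and e: "\<And>t. t \<in> {0..T} \<Longrightarrow> (e has_real_derivative e' t) (at t within {0..T})"
    and e': "\<And>t. t \<in> {0..T} \<Longrightarrow> (e' has_real_derivative - (\<kappa> * e t)) (at t within {0..T})"
    and t: "t \<in> {0..T}"
  shows "e t = 0" "e' t = 0"
proof -
  have "((\<lambda>s. (e' s)\<^sup>2 + \<kappa> * (e s)\<^sup>2) has_real_derivative 0) (at s within {0..T})" if "s \<in> {0..T}" for s
    using e[OF that] e'[OF that] by (auto intro!: derivative_eq_intros simp: algebra_simps)
  from has_field_derivative_zero_constant[OF convex_real_interval(5) this]
  obtain c where c: "\<forall>s\<in>{0..T}. (e' s)\<^sup>2 + \<kappa> * (e s)\<^sup>2 = c" by blast
  have "c = 0" using bspec[OF c, of 0] assms(2,3) t by simp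
  then have "(e' t)\<^sup>2 + \<kappa> * (e t)\<^sup>2 = 0" using c t by simp
  moreover have "0 \<le> \<kappa> * (e t)\<^sup>2" using assms(1) by simp
  ultimately have "(e' t)\<^sup>2 = 0 \<and> \<kappa> * (e t)\<^sup>2 = 0"
    by (smt (verit) zero_le_power2)
  then show "e t = 0" "e' t = 0" using assms(1) by auto
qed

lemma modal_stiffness_mult:
  assumes "ev k > 0"
  shows "(modal_stiffness c0 ev *v v) $ k = c0\<^sup>2 * ev k * v $ k"
proof -
  have "(modal_stiffness c0 ev *v v) $ k = (modal_frequency c0 ev k)\<^sup>2 * v $ k"
    unfolding modal_stiffness_def matrix_vector_mult_def
    by (simp add: if_distrib[of "\<lambda>z. z * _"] cong: if_cong)
  then show ?thesis using assms by (simp add: modal_frequency_def power_mult_distrib)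
qed

text \<open>The common input cancels in the difference, and the stiffness matrix is diagonal. Each
  component is therefore a free scalar oscillator with constant \<open>c0\<^sup>2 * ev k\<close> and
  zero initial data.\<close>

lemma modal_solution_unique:
  assumes "c0 > 0" "\<And>k. ev k > 0"
    and a: "modal_solution c0 T ev C q a" and b: "modal_solution c0 T ev C q b"
    and t: "t \<in> {0..T}"
  shows "a t = b t" "time_deriv T a t = time_deriv T b t"
proof -
  let ?e = "\<lambda>k t. a t $ k - b t $ k" and ?e' = "\<lambda>k t. time_deriv T a t $ k - time_deriv T b t $ k"
  have "?e k t = 0 \<and> ?e' k t = 0" for k
  proof -
    note init = a[unfolded modal_solution_def] b[unfolded modal_solution_def]
    note nth = bounded_linear.has_vector_derivative[OF bounded_linear_vec_nth[of k]]
    have e: "(?e k has_real_derivative ?e' k s) (at s within {0..T})" if "s \<in> {0..T}" for s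
      using a b that unfolding modal_solution_def has_real_derivative_iff_has_vector_derivative
      by (intro has_vector_derivative_diff nth Ck_time_2D) auto
    have e': "(?e' k has_real_derivative - (c0\<^sup>2 * ev k * ?e k s)) (at s within {0..T})"
      if s: "s \<in> {0..T}" for s
    proof -
      have "time_deriv T (time_deriv T a) s + modal_stiffness c0 ev *v a s
          = time_deriv T (time_deriv T b) s + modal_stiffness c0 ev *v b s"
        using a b s unfolding modal_solution_def by simp
      then have "time_deriv T (time_deriv T a) s $ k + c0\<^sup>2 * ev k * a s $ k
          = time_deriv T (time_deriv T b) s $ k + c0\<^sup>2 * ev k * b s $ k"
        by (metis vector_add_component modal_stiffness_mult assms(2))
      then have "- (c0\<^sup>2 * ev k * ?e k s)
          = time_deriv T (time_deriv T a) s $ k - time_deriv T (time_deriv T b) s $ k"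
        by (simp add: algebra_simps)
      then show ?thesis
        using a b s unfolding modal_solution_def has_real_derivative_iff_has_vector_derivative
        by (simp only:) (intro has_vector_derivative_diff nth Ck_time_2D, auto)
    qed
    have "c0\<^sup>2 * ev k > 0" "?e k 0 = 0" "?e' k 0 = 0"
      using assms(1,2) init by simp_all
    from oscillator_zero[OF this e e' t] show ?thesis by blast
  qed
  then show "a t = b t" "time_deriv T a t = time_deriv T b t"
    by (simp_all add: vec_eq_iff)
qed

text \<open>Applying \<open>C\<close> to the ideal input cancels \<open>L\<close>, and
  \<open>c0\<^sup>2\<close> cancels its reciprocal; what remains is the left side of the modal
  equation for \<open>pr\<close>.\<close>

lemma modal_solution_reference:
  assumes "c0 > 0" "C ** L = mat 1" "Ck_time 2 T pr" "pr 0 = 0" "time_deriv T pr 0 = 0"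
  shows "modal_solution c0 T ev C (q_ideal c0 T ev L pr) pr"
  using assms unfolding modal_solution_def q_ideal_def
  by (simp add: matrix_vector_mult_scaleR matrix_vector_mul_assoc)

section \<open>From Galerkin solutions to classical modal solutions\<close>

lemma continuous_on_matrix_vector_mult [continuous_intros]:
  fixes A :: "real^'n::finite^'m::finite"
  shows "continuous_on S f \<Longrightarrow> continuous_on S (\<lambda>t. A *v f t)"
  by (rule bounded_linear.continuous_on[OF matrix_vector_mul_bounded_linear])

lemma continuous_on_q_ideal:
  assumes "Ck_time 2 T pr"
  shows "continuous_on {0..T} (q_ideal c0 T ev L pr)"
proof -
  have "continuous_on {0..T} pr"
    by (rule continuous_on_vector_derivative[OF Ck_time_2D(1)[OF assms]])
  moreover have "continuous_on {0..T} (time_deriv T (time_deriv T pr))"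
    using assms by (simp add: numeral_2_eq_2)
  ultimately show ?thesis
    unfolding q_ideal_def[abs_def] by (intro continuous_intros)
qed

text \<open>With a continuous input, \<open>a2\<close> agrees almost everywhere with a continuous
  function, and integrals do not notice the exceptional set.\<close>

lemma (in orthonormal_modes) galerkin_imp_modal_solution:
  assumes "c0 > 0" "T > 0" "\<And>k. ev k > 0" "\<And>k. dirichlet_eigenfunction \<Omega> (ev k) (\<psi> k)"
    and q: "continuous_on {0..T} q" and a: "galerkin_solution \<Omega> c0 T \<psi> y q a"
  shows "modal_solution c0 T ev (control_matrix \<psi> y) q a"
proof -
  let ?C = "control_matrix \<psi> y"
  \<comment> \<open>The second derivative that the modal equation prescribes along
    \<open>a\<close>.\<close>
  define f where "f t = c0\<^sup>2 *\<^sub>R (?C *v q t) - modal_stiffness c0 ev *v a t" for t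
  obtain a2 where a2: "\<And>t. t \<in> {0..T} \<Longrightarrow>
        (a has_vector_derivative (time_deriv T a 0 + integral {0..t} a2)) (at t within {0..T})"
    and weak: "AE t in lebesgue. t \<in> {0..T} \<longrightarrow> (\<forall>\<phi>\<in>modal_space \<psi>.
           1 / c0\<^sup>2 * l2_inner \<Omega> (modal_field \<psi> (a2 t)) \<phi> + dirichlet_form \<Omega> (modal_field \<psi> (a t)) \<phi>
             = (\<Sum>\<alpha>\<in>UNIV. q t $ \<alpha> * \<phi> (y \<alpha>)))"
    and 0: "a 0 = 0" "time_deriv T a 0 = 0"
    using a unfolding galerkin_solution_def by blast
  have f: "continuous_on {0..T} f"
    unfolding f_def[abs_def]
    by (intro continuous_intros q continuous_on_vector_derivative[OF a2])
  have "AE t in lebesgue. t \<in> {0..T} \<longrightarrow> a2 t = f t"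
    using weak
  proof eventually_elim
    case (elim t)
    show ?case
    proof
      assume "t \<in> {0..T}"
      have "a2 t $ k = f t $ k" for k
      proof -
        have "1 / c0\<^sup>2 * a2 t $ k + ev k * a t $ k = (\<Sum>\<alpha>\<in>UNIV. q t $ \<alpha> * \<psi> k (y \<alpha>))"
          using bspec[OF mp[OF elim \<open>t \<in> {0..T}\<close>] mode_in_modal_space[of k]]
          by (simp add: l2_inner_modal_field_mode dirichlet_form_modal_field_mode[OF assms(4)])
        also have "\<dots> = (?C *v q t) $ k"
          by (simp add: control_matrix_def matrix_vector_mult_def mult.commute)
        finally show ?thesis
          using \<open>c0 > 0\<close> by (simp add: f_def modal_stiffness_mult assms(3) field_simps)
      qed
      then show "a2 t = f t" by (simp add: vec_eq_iff)
    qed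
  qed
  then obtain N where N: "N \<in> null_sets lebesgue" "\<And>t. t \<in> {0..T} - N \<Longrightarrow> a2 t = f t"
    by (auto elim!: AE_E3 simp: null_sets_def)
  have "integral {0..t} a2 = integral {0..t} f" if "t \<in> {0..T}" for t
    by (rule integral_spike[of N])
       (use N that in \<open>auto simp: negligible_iff_null_sets\<close>)
  \<comment> \<open>The zero initial velocity removes the constant in front of the integral.\<close>
  then have a1: "(a has_vector_derivative integral {0..t} f) (at t within {0..T})" if "t \<in> {0..T}" for t
    using a2[OF that] that by (simp add: 0)
  \<comment> \<open>By the fundamental theorem of calculus the continuous \<open>f\<close> is the
    second derivative at every time, and its definition is the modal equation.\<close>
  note Ck_time_2I[OF assms(2) f a1 integral_has_vector_derivative[OF f]]
  then show ?thesis
    unfolding modal_solution_def using 0 by (simp add: f_def)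
qed

section \<open>Identification of the projected field with the reference field\<close>

theorem theorem3p2:
  fixes \<Omega> :: "(real^3) set"
    and c0 T :: real
    and \<psi> :: "'m::finite \<Rightarrow> real^3 \<Rightarrow> real"
    and ev :: "'m \<Rightarrow> real"
    and y :: "'n::finite \<Rightarrow> real^3"
    and L :: "real^'m^'n"
    and pr :: "real \<Rightarrow> real^'m"
  assumes "bounded_C11_domain \<Omega>"
    and "c0 > 0"
    and "\<And>k. ev k > 0"
    and "\<And>k. dirichlet_eigenfunction \<Omega> (ev k) (\<psi> k)"
    and "\<And>j k. l2_inner \<Omega> (\<psi> j) (\<psi> k) = (if j = k then 1 else 0)"
    and "CARD('n) \<ge> CARD('m)"
    and "\<And>\<alpha>. y \<alpha> \<in> \<Omega>"
    and "rank (control_matrix \<psi> y) = CARD('m)"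
    and "control_matrix \<psi> y ** L = mat 1"
    and "T > 0"
    and "Ck_time 3 T pr"
    and "pr 0 = 0"
    and "time_deriv T pr 0 = 0"
  shows
    "(\<exists>pM. modal_solution c0 T ev (control_matrix \<psi> y) (q_ideal c0 T ev L pr) pM) \<and>
     (\<forall>pM. modal_solution c0 T ev (control_matrix \<psi> y) (q_ideal c0 T ev L pr) pM \<longrightarrow>
        (\<forall>t\<in>{0..T}. pM t = pr t \<and> time_deriv T pM t = time_deriv T pr t)) \<and>
     (\<forall>p. point_actuated_field \<Omega> c0 T \<psi> y (q_ideal c0 T ev L pr) p \<longrightarrow>
        (\<forall>t\<in>{0..T}.
           orth_proj \<Omega> (modal_space \<psi>) (p t) = modal_field \<psi> (pr t) \<and>
           (\<forall>\<phi>\<in>modal_space \<psi>. (\<lambda>s. l2_inner \<Omega> (p s) \<phi>) differentiable (at t within {0..T})) \<and>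
           orth_proj_functional \<Omega> (modal_space \<psi>) (field_deriv_functional \<Omega> T p t)
             = (\<lambda>x. time_deriv T (\<lambda>s. modal_field \<psi> (pr s) x) t) \<and>
           (\<forall>v. has_weak_L2_time_deriv \<Omega> T p t v \<longrightarrow>
              orth_proj \<Omega> (modal_space \<psi>) v
                = (\<lambda>x. time_deriv T (\<lambda>s. modal_field \<psi> (pr s) x) t))))"
proof -
  interpret orthonormal_modes \<Omega> \<psi>
  proof
    show "square_integrable \<Omega> (\<psi> k)" for k
      using assms(4)[of k] H10_square_integrable
      unfolding dirichlet_eigenfunction_def neg_dirichlet_laplacian_def by blast
  qed (rule assms(5))
  let ?C = "control_matrix \<psi> y" and ?q = "q_ideal c0 T ev L pr" and ?V = "modal_space \<psi>"
  \<comment> \<open>The second derivative is continuous because it is differentiable within the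
    interval.\<close>
  have pr: "Ck_time 2 T pr"
    using assms(11) by (auto simp: numeral_2_eq_2 numeral_3_eq_3
        intro: continuous_at_imp_continuous_on differentiable_imp_continuous_within
          simp: continuous_on_eq_continuous_within)
  have ref: "modal_solution c0 T ev ?C ?q pr"
    using assms(2,9,12,13) pr by (intro modal_solution_reference)
  have unique: "a t = pr t" "time_deriv T a t = time_deriv T pr t"
    if "modal_solution c0 T ev ?C ?q a" "t \<in> {0..T}" for a t
    using modal_solution_unique[OF assms(2,3) that(1) ref that(2)] by auto
  note pr' = Ck_time_2D(1)[OF pr]
  have nth: "((\<lambda>s. pr s $ k) has_real_derivative time_deriv T pr t $ k) (at t within {0..T})"
    if "t \<in> {0..T}" for t k
    unfolding has_real_derivative_iff_has_vector_derivative
    by (rule bounded_linear.has_vector_derivative[OF bounded_linear_vec_nth pr'[OF that]])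
  have sum: "((\<lambda>s. \<Sum>k\<in>UNIV. pr s $ k * c k) has_real_derivative
      (\<Sum>k\<in>UNIV. time_deriv T pr t $ k * c k)) (at t within {0..T})" if "t \<in> {0..T}" for t c
    by (intro DERIV_sum DERIV_cmult_right nth that)
  \<comment> \<open>At fixed \<open>x\<close> only the coefficients depend on time, so the pointwise
    derivative of the reference field is again a modal field.\<close>
  have field: "(\<lambda>x. time_deriv T (\<lambda>s. modal_field \<psi> (pr s) x) t) = modal_field \<psi> (time_deriv T pr t)"
    if "t \<in> {0..T}" for t
    unfolding modal_field_def[abs_def]
    using sum[OF that, unfolded has_real_derivative_iff_has_vector_derivative]
    by (intro ext time_deriv_eqI assms(10) that)
  have projections: "orth_proj \<Omega> ?V (p t) = modal_field \<psi> (pr t) \<and>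
      (\<forall>\<phi>\<in>?V. (\<lambda>s. l2_inner \<Omega> (p s) \<phi>) differentiable (at t within {0..T})) \<and>
      orth_proj_functional \<Omega> ?V (field_deriv_functional \<Omega> T p t) = modal_field \<psi> (time_deriv T pr t) \<and>
      (\<forall>v. has_weak_L2_time_deriv \<Omega> T p t v \<longrightarrow>
        orth_proj \<Omega> ?V v = modal_field \<psi> (time_deriv T pr t))"
    if p: "point_actuated_field \<Omega> c0 T \<psi> y ?q p" and t: "t \<in> {0..T}" for p t
  proof -
    obtain a where a: "galerkin_solution \<Omega> c0 T \<psi> y ?q a"
      and proj_a: "\<And>s. s \<in> {0..T} \<Longrightarrow> orth_proj \<Omega> ?V (p s) = modal_field \<psi> (a s)"
      and sq: "\<And>s. s \<in> {0..T} \<Longrightarrow> square_integrable \<Omega> (p s)"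
      using p unfolding point_actuated_field_def by blast
    have "modal_solution c0 T ev ?C ?q a"
      by (intro galerkin_imp_modal_solution assms(2,3,4,10) continuous_on_q_ideal pr a)
    then have proj: "orth_proj \<Omega> ?V (p s) = modal_field \<psi> (pr s)" if "s \<in> {0..T}" for s
      using proj_a unique(1) that by simp
    \<comment> \<open>Two expressions for the same projection are compared through the injectivity
      of \<open>modal_field\<close>.\<close>
    have coeff: "l2_inner \<Omega> (p s) (\<psi> k) = pr s $ k" if "s \<in> {0..T}" for s k
      using proj[OF that] orth_proj_modal_space[OF sq[OF that]]
      by (auto simp: modal_field_inject vec_eq_iff)
    \<comment> \<open>On the interval the pairing is a finite sum of reference coefficients, so it
      is differentiable even if \<open>p\<close> has no time derivative in
      \<open>L\<^sup>2\<close>.\<close>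
    have inner: "((\<lambda>s. l2_inner \<Omega> (p s) (modal_field \<psi> b)) has_real_derivative
        (\<Sum>k\<in>UNIV. b $ k * time_deriv T pr t $ k)) (at t within {0..T})" for b
          unfolding has_real_derivative_iff_has_vector_derivative
    proof (rule has_vector_derivative_transform[OF t])
      show "((\<lambda>s. \<Sum>k\<in>UNIV. pr s $ k * b $ k) has_vector_derivative
          (\<Sum>k\<in>UNIV. b $ k * time_deriv T pr t $ k)) (at t within {0..T})"
        using sum[OF t, of "\<lambda>k. b $ k"]
        by (simp add: mult.commute has_real_derivative_iff_has_vector_derivative)
    qed (simp add: l2_inner_modal_field_right sq coeff mult.commute)
    have "(\<lambda>s. l2_inner \<Omega> (p s) \<phi>) differentiable (at t within {0..T})" if "\<phi> \<in> ?V" for \<phi>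
      using that differentiableI_vector[OF inner[unfolded has_real_derivative_iff_has_vector_derivative]]
      unfolding modal_space_def by auto
    moreover have "orth_proj_functional \<Omega> ?V (field_deriv_functional \<Omega> T p t)
        = modal_field \<psi> (time_deriv T pr t)"
      using inner unfolding has_real_derivative_iff_has_vector_derivative
      by (intro orth_proj_functional_modal_space)
         (auto simp: field_deriv_functional_def intro: time_deriv_eqI assms(10) t)
    moreover have "orth_proj \<Omega> ?V v = modal_field \<psi> (time_deriv T pr t)"
      if v: "has_weak_L2_time_deriv \<Omega> T p t v" for v
    proof -
      \<comment> \<open>Both numbers are derivatives at \<open>t\<close> of the same coefficient
        \<open>pr s $ k\<close>: one by the weak derivative tested with the mode, the other by
        regularity of \<open>pr\<close>.\<close>
      have "l2_inner \<Omega> v (\<psi> k) = time_deriv T pr t $ k" for k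
      proof -
        have "((\<lambda>s. l2_inner \<Omega> (p s) (\<psi> k)) has_real_derivative l2_inner \<Omega> v (\<psi> k)) (at t within {0..T})"
          using v square_integrable_mode unfolding has_weak_L2_time_deriv_def by blast
        then have "((\<lambda>s. pr s $ k) has_vector_derivative l2_inner \<Omega> v (\<psi> k)) (at t within {0..T})"
          unfolding has_real_derivative_iff_has_vector_derivative
          by (rule has_vector_derivative_transform[OF t, rotated]) (simp add: coeff)
        moreover have "((\<lambda>s. pr s $ k) has_vector_derivative time_deriv T pr t $ k) (at t within {0..T})"
          using nth[OF t] by (simp add: has_real_derivative_iff_has_vector_derivative)
        ultimately show ?thesis
          using time_deriv_eqI[OF _ assms(10) t] by metis
      qed
      then show ?thesis
        using v orth_proj_modal_space unfolding has_weak_L2_time_deriv_def by simp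
    qed
    ultimately show ?thesis using proj[OF t] by blast
  qed
  show ?thesis
  proof (intro conjI exI[of _ pr] allI impI ballI)
    show "modal_solution c0 T ev ?C ?q pr" by (rule ref)
    fix pM t assume "modal_solution c0 T ev ?C ?q pM" "t \<in> {0..T}"
    then show "pM t = pr t" "time_deriv T pM t = time_deriv T pr t" by (rule unique)+
  qed (use projections field in auto)
qed

end
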